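(* Let $T$ be a tree with a root vertex $v_0$ that has degree $d$ for some integer $d \geq 1$. Suppose that $v_0$ is not adjacent to any vertex of degree $1$, that $T$ has exactly $d$ vertices each of which has degree $d+2$, and that all other vertices of $T$ (other than $v_0$ and these $d$ vertices) are of degree $1$. Then $T$ can be represented as (is graph-isomorphic to) $(d+1)\text{-}G(Z_n)$, where $n = (d+1)^2$. Furthermore, $\operatorname{diam}(T) = 2$ if $d = 1$, and $\operatorname{diam}(T) = 4$ if $d \neq 1$.
   Context: $Z_n$ is the additive cyclic group of integers modulo $n$. For an integer $r>1$, the graph $r\text{-}G(Z_n)$ is the simple undirected graph with vertex set $Z_n$ in which two distinct vertices $a,b$ are adjacent if and only if $ra=b$ or $rb=a$ in $Z_n$. The diameter of a graph is the maximum of the distances (lengths of shortest paths) over all pairs of vertices. *)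

theory Defs
  imports "Graph_Theory.Graph_Theory" "HOL-Algebra.Elementary_Groups"
begin

text \<open>
  A simple undirected graph is a loop-free symmetric pair digraph: the edge between \<open>u\<close> and \<open>v\<close>
  is the pair of arcs \<open>(u, v)\<close> and \<open>(v, u)\<close>. Hence the degree of a vertex is its
  \<^const>\<open>out_degree\<close>, and graph isomorphism is \<^const>\<open>digraph_iso\<close>.

  The library's \<^const>\<open>tree\<close> cannot be used in this representation: it forbids all directed
  cycles, and every edge traversed back and forth is a directed cycle of length 2. The cycles of
  the undirected graph are exactly the directed cycles with at least three arcs.
\<close>

definition undirected_tree :: "'a pair_pre_digraph \<Rightarrow> bool" where
  "undirected_tree G \<longleftrightarrow>
     pair_bidirected_digraph G \<and>
     connected (with_proj G) \<and>
     \<not> (\<exists>p. pre_digraph.cycle (with_proj G) p \<and> length p \<ge> 3)"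

text \<open>
  With unit arc weights, \<open>\<mu>\<close> is the length of a shortest path (\<open>\<infinity>\<close> if there is none). The supremum
  is the maximum whenever the graph is finite and nonempty.
\<close>

definition graph_dist :: "'a pair_pre_digraph \<Rightarrow> 'a \<Rightarrow> 'a \<Rightarrow> ereal" where
  "graph_dist G u v = wf_digraph.\<mu> (with_proj G) (\<lambda>_. 1) u v"

definition diameter :: "'a pair_pre_digraph \<Rightarrow> ereal" where
  "diameter G = (SUP (u, v) \<in> pverts G \<times> pverts G. graph_dist G u v)"

text \<open>
  The graph \<open>r-G(Z\<^sub>n)\<close>; since the group is written multiplicatively in the library, \<open>ra\<close> is
  the power \<open>a [^] r\<close>, that is, \<open>(r * a) mod n\<close>. It is meant for \<open>r > 1\<close> and \<open>n > 0\<close>.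
\<close>

definition r_G :: "nat \<Rightarrow> nat \<Rightarrow> int pair_pre_digraph" where
  "r_G r n =
    \<lparr> pverts = carrier (integer_mod_group n),
      parcs = {(a, b). a \<in> carrier (integer_mod_group n) \<and> b \<in> carrier (integer_mod_group n) \<and>
                 a \<noteq> b \<and>
                 (a [^]\<^bsub>integer_mod_group n\<^esub> r = b \<or> b [^]\<^bsub>integer_mod_group n\<^esub> r = a)} \<rparr>"

end

theory Submission
  imports Defs "HOL-Combinatorics.Transposition"
begin

text \<open>
  Both graphs are graphs of a self-map: two distinct vertices are adjacent iff the map sends one of
  them to the other. For \<open>r-G(Z\<^sub>n)\<close> with \<open>r = d + 1\<close>, \<open>n = r\<^sup>2\<close> the map is multiplication by \<open>r\<close>;
  for \<open>T\<close> it is the map \<open>p\<close> that moves every vertex one step towards the root and fixes the root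
  (\<open>rooted_tree_parent_map\<close>). It therefore suffices to find a bijection that turns one map into the
  other (\<open>functional_graph_iso\<close>).

  In base \<open>r\<close>, multiplication by \<open>r\<close> on \<open>Z\<close> modulo \<open>r\<^sup>2\<close> shifts the two digits and fills in a zero.
  So its square is constantly \<open>0\<close>, and every number that it sends to \<open>0\<close> is the image of exactly \<open>r\<close>
  numbers. These properties determine a self-map up to conjugation: numbering each fibre by
  \<open>0, \<dots>, r - 1\<close>, with the root numbered \<open>0\<close>, a vertex \<open>x\<close> is coded by the digits \<open>j x\<close> and
  \<open>j (p x)\<close>, and \<open>p\<close> becomes the shift because \<open>p (p x)\<close> is the root
  (\<open>conjugate_to_multiplication\<close>).

  The parent map of \<open>T\<close> has these properties. All \<open>d\<close> neighbours of \<open>v\<^sub>0\<close> have degree different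
  from \<open>1\<close>, hence they are precisely the \<open>d\<close> vertices of degree \<open>d + 2\<close>. No two of them are adjacent,
  since that would close a triangle, so each has \<open>d + 1\<close> further neighbours, which are leaves.
  Every leaf arises in this way, because two adjacent leaves would form a component without \<open>v\<^sub>0\<close>.

  For the diameter, walks to a central vertex give the upper bound: the root has eccentricity \<open>2\<close>,
  and for \<open>d = 1\<close> its only child has eccentricity \<open>1\<close>. A function that changes by at most \<open>1\<close> along
  every edge gives the lower bound.
\<close>

section \<open>Bounds on distances and on the diameter\<close>

lemma (in wf_digraph) awalk_cost_unit: "awalk_cost (\<lambda>_. 1) p = real (length p)"
  by (induction p) auto

lemma (in pair_wf_digraph) graph_dist_le_length:
  assumes "awalk u p v"
  shows "graph_dist G u v \<le> ereal (real (length p))"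
  using min_cost_le_walk_cost[OF assms, of "\<lambda>_. 1"]
  unfolding graph_dist_def by (simp add: awalk_cost_unit)

text \<open>
  Lower bounds on distances come from potentials: along a walk of length \<open>k\<close>, the single changes
  of \<open>f\<close> telescope to at most \<open>k\<close>.
\<close>

lemma (in pair_wf_digraph) graph_dist_ge_potential:
  fixes f :: "'a \<Rightarrow> int"
  assumes lip: "\<And>a b. (a, b) \<in> parcs G \<Longrightarrow> \<bar>f a - f b\<bar> \<le> 1"
  shows "ereal (real_of_int \<bar>f u - f v\<bar>) \<le> graph_dist G u v"
proof -
  have "\<bar>f u - f v\<bar> \<le> int (length p)" if "awalk u p v" for p
    using that
  proof (induction p arbitrary: u)
    case (Cons e es)
    then have "\<bar>f u - f (snd e)\<bar> \<le> 1" "\<bar>f (snd e) - f v\<bar> \<le> int (length es)"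
      using lip[of "fst e" "snd e"] by (auto simp: awalk_Cons_iff)
    then show ?case by simp
  qed (auto simp: awalk_Nil_iff)
  then have "real_of_int \<bar>f u - f v\<bar> \<le> real (length p)" if "awalk u p v" for p
    using that by (metis of_int_le_iff of_int_of_nat_eq)
  then show ?thesis
    unfolding graph_dist_def \<mu>_def
    by (intro INF_greatest) (simp add: awalk_cost_unit)
qed

lemma graph_dist_le_diameter:
  "u \<in> pverts G \<Longrightarrow> v \<in> pverts G \<Longrightarrow> graph_dist G u v \<le> diameter G"
  unfolding diameter_def by (rule SUP_upper2[of "(u, v)"]) auto

lemma length_rev_path [simp]: "length (rev_path p) = length p"
  by (induction p) auto

text \<open>Any two vertices are joined by going to \<open>c\<close> along one walk and back along the reverse of another.\<close>

lemma (in pair_sym_digraph) diameter_le_twice_eccentricity: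
  assumes "\<And>v. v \<in> pverts G \<Longrightarrow> \<exists>p. awalk v p c \<and> length p \<le> k"
  shows "diameter G \<le> ereal (real (2 * k))"
  unfolding diameter_def
proof (rule SUP_least, clarify)
  fix u v assume uv: "u \<in> pverts G" "v \<in> pverts G"
  obtain p q where p: "awalk u p c" "length p \<le> k" and q: "awalk v q c" "length q \<le> k"
    using assms uv by meson
  have "awalk u (p @ rev_path q) v"
    using p q by (intro awalk_appendI[of u p c]) auto
  then have "graph_dist G u v \<le> ereal (real (length (p @ rev_path q)))"
    by (rule graph_dist_le_length)
  also have "\<dots> \<le> ereal (real (2 * k))"
    using p q by simp
  finally show "graph_dist G u v \<le> ereal (real (2 * k))" .
qed

section \<open>The graph of a self-map\<close>

definition functional_graph :: "'a set \<Rightarrow> ('a \<Rightarrow> 'a) \<Rightarrow> 'a pair_pre_digraph" where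
  "functional_graph V p =
     \<lparr> pverts = V, parcs = {(a, b). a \<in> V \<and> b \<in> V \<and> a \<noteq> b \<and> (p a = b \<or> p b = a)} \<rparr>"

lemma functional_graph_simps [simp]:
  "pverts (functional_graph V p) = V"
  "(a, b) \<in> parcs (functional_graph V p) \<longleftrightarrow> a \<in> V \<and> b \<in> V \<and> a \<noteq> b \<and> (p a = b \<or> p b = a)"
  by (auto simp: functional_graph_def)

lemma r_G_functional_graph:
  "r_G r n = functional_graph (carrier (integer_mod_group n)) (\<lambda>a. (int r * a) mod int n)"
  by (simp add: r_G_def functional_graph_def)

lemma pair_sym_digraph_functional_graph: "pair_sym_digraph (functional_graph V p)"
  by unfold_locales
    (auto simp: functional_graph_def symmetric_def sym_def)

text \<open>
  Adjacency is expressed by the self-map alone, so a bijection that conjugates the maps preserves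
  and reflects it.
\<close>

lemma functional_graph_iso:
  assumes bij: "bij_betw f V W"
    and closed: "\<And>x. x \<in> V \<Longrightarrow> p x \<in> V"
    and conj: "\<And>x. x \<in> V \<Longrightarrow> f (p x) = q (f x)"
  shows "digraph_iso (with_proj (functional_graph V p)) (with_proj (functional_graph W q))"
proof -
  define hom where "hom = \<lparr> iso_verts = f, iso_arcs = map_prod f f, iso_head = snd, iso_tail = fst \<rparr>"
  interpret pair_sym_digraph "functional_graph V p" by (rule pair_sym_digraph_functional_graph)
  have inj: "inj_on f V" and img: "f ` V = W"
    using bij by (auto simp: bij_betw_def)
  have arcs_V: "parcs (functional_graph V p) \<subseteq> V \<times> V"
    by auto
  have "inj_on (map_prod f f) (parcs (functional_graph V p))"
    using map_prod_inj_on[OF inj inj] arcs_V by (rule inj_on_subset)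
  then have "digraph_isomorphism hom"
    using inj wf_digraph_axioms by (auto simp: digraph_isomorphism_def hom_def)
  moreover have "map_prod f f ` parcs (functional_graph V p) = parcs (functional_graph W q)"
  proof (intro equalityI subsetI)
    fix e assume "e \<in> map_prod f f ` parcs (functional_graph V p)"
    then show "e \<in> parcs (functional_graph W q)"
      using inj by (auto simp: img[symmetric] conj inj_on_eq_iff dest!: conj)
  next
    fix e assume "e \<in> parcs (functional_graph W q)"
    then obtain a b where ab: "e = (f a, f b)" "a \<in> V" "b \<in> V" "f a \<noteq> f b"
        "q (f a) = f b \<or> q (f b) = f a"
      by (cases e) (auto simp: img[symmetric])
    then have "p a = b \<or> p b = a"
      using conj closed inj by (metis inj_on_eq_iff)
    with ab show "e \<in> map_prod f f ` parcs (functional_graph V p)"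
      by (intro image_eqI[of _ _ "(a, b)"]) auto
  qed
  ultimately show ?thesis
    unfolding digraph_iso_def
    by (intro exI[of _ hom]) (simp add: app_iso_def hom_def with_proj_def img)
qed

section \<open>Self-maps that reach the root in two steps\<close>

text \<open>
  The graph of such a map is a rooted tree of depth \<open>2\<close>. As the root is a fixed point, its fibre
  consists of itself and of its \<open>r - 1\<close> children; the fibre of a child consists of \<open>r\<close> leaves.
\<close>

locale two_step_map =
  fixes V :: "'a set" and p :: "'a \<Rightarrow> 'a" and root :: 'a and r :: nat
  assumes root_in: "root \<in> V"
    and closed: "x \<in> V \<Longrightarrow> p x \<in> V"
    and two_steps: "x \<in> V \<Longrightarrow> p (p x) = root"
    and card_fibre: "y \<in> V \<Longrightarrow> p y = root \<Longrightarrow> card {x \<in> V. p x = y} = r"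
    and r_pos: "r > 0"
begin

lemma p_root [simp]: "p root = root"
  using two_steps[of root] two_steps[of "p root"] closed root_in by simp

lemma fibre_nonempty:
  assumes "y \<in> V" "p y = root"
  obtains x where "x \<in> V" "p x = y"
proof -
  have "card {x \<in> V. p x = y} > 0"
    using card_fibre[OF assms] r_pos by simp
  with that show thesis
    by (auto simp: card_gt_0_iff)
qed

lemma number_fibre:
  assumes "y \<in> V" "p y = root" "a \<in> V" "p a = y"
  shows "\<exists>h. bij_betw h {x \<in> V. p x = y} {0..<r} \<and> h a = 0"
proof -
  have card: "card {x \<in> V. p x = y} = r"
    using assms card_fibre by simp
  moreover have "finite {x \<in> V. p x = y}"
    using card r_pos by (metis card.infinite less_numeral_extra(3))
  ultimately obtain h where h: "bij_betw h {x \<in> V. p x = y} {0..<r}"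
    using ex_bij_betw_finite_nat by metis
  then have "h a < r"
    using assms bij_betwE by fastforce
  with r_pos have "bij_betw (transpose 0 (h a)) {0..<r} {0..<r}"
    by (intro bij_betw_transpose_iff) auto
  with h have "bij_betw (transpose 0 (h a) \<circ> h) {x \<in> V. p x = y} {0..<r}"
    by (rule bij_betw_trans)
  then show ?thesis
    by (intro exI[of _ "transpose 0 (h a) \<circ> h"]) simp
qed

text \<open>
  Within the fibre of \<open>root\<close>, the number \<open>j\<close> names a child of the root (or the root itself); within
  the fibre of a child it names a leaf. The vertex \<open>x\<close> becomes the number with digits \<open>j (p x)\<close> (low)
  and \<open>j x\<close> (high).
\<close>

lemma conjugate_to_multiplication:
  obtains f :: "'a \<Rightarrow> int" where
    "bij_betw f V (carrier (integer_mod_group (r\<^sup>2)))"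
    "\<And>x. x \<in> V \<Longrightarrow> f (p x) = (int r * f x) mod int (r\<^sup>2)"
proof -
  have "\<forall>y\<in>V. p y = root \<longrightarrow>
          (\<exists>h. bij_betw h {x \<in> V. p x = y} {0..<r} \<and> (y = root \<longrightarrow> h root = 0))"
  proof (intro ballI impI)
    fix y assume y: "y \<in> V" "p y = root"
    obtain a where "a \<in> V" "p a = y"
      using fibre_nonempty[OF y] .
    then show "\<exists>h. bij_betw h {x \<in> V. p x = y} {0..<r} \<and> (y = root \<longrightarrow> h root = 0)"
      using number_fibre[OF y] number_fibre[OF y root_in] by (cases "y = root") auto
  qed
  then obtain h where h: "\<And>y. y \<in> V \<Longrightarrow> p y = root \<Longrightarrow> bij_betw (h y) {x \<in> V. p x = y} {0..<r}"
      and h_root: "h root root = 0"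
    using root_in by (metis p_root)
  define j where "j x = h (p x) x" for x
  have j_bij: "bij_betw j {x \<in> V. p x = y} {0..<r}" if "y \<in> V" "p y = root" for y
    using h[OF that] by (rule bij_betw_cong[THEN iffD1, rotated]) (auto simp: j_def)
  have j_less: "j x < r" if "x \<in> V" for x
    using bij_betwE[OF j_bij[of "p x"]] that closed two_steps by auto
  have j_root: "j root = 0"
    by (simp add: j_def h_root)
  define f where "f x = j (p x) + r * j x" for x
  have low: "f x mod r = j (p x)" and high: "f x div r = j x" if "x \<in> V" for x
    using j_less[of "p x"] closed that by (simp_all add: f_def)
  have "inj_on f V"
  proof (rule inj_onI)
    fix x y assume xy: "x \<in> V" "y \<in> V" "f x = f y"
    then have "j (p x) = j (p y)" and j_eq: "j x = j y"
      using low[of x] low[of y] high[of x] high[of y] by auto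
    then have "p x = p y"
      using bij_betw_imp_inj_on[OF j_bij[of root]] xy closed two_steps root_in
      by (auto dest: inj_onD)
    then show "x = y"
      using bij_betw_imp_inj_on[OF j_bij[of "p x"]] xy closed two_steps j_eq
      by (auto dest: inj_onD)
  qed
  moreover have "f ` V = {0..<r\<^sup>2}"
  proof (intro equalityI subsetI)
    fix z assume "z \<in> f ` V"
    then have "z div r < r"
      using high j_less by auto
    then show "z \<in> {0..<r\<^sup>2}"
      using r_pos by (simp add: power2_eq_square div_less_iff_less_mult)
  next
    fix z assume z: "z \<in> {0..<r\<^sup>2}"
    then have "z div r \<in> {0..<r}"
      using r_pos by (simp add: power2_eq_square div_less_iff_less_mult)
    have "z mod r \<in> j ` {x \<in> V. p x = root}"
      using bij_betw_imp_surj_on[OF j_bij[of root]] root_in r_pos by simp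
    then obtain y where y: "y \<in> V" "p y = root" "j y = z mod r"
      by auto
    then have "z div r \<in> j ` {x \<in> V. p x = y}"
      using bij_betw_imp_surj_on[OF j_bij[of y]] \<open>z div r \<in> {0..<r}\<close> by simp
    then obtain x where x: "x \<in> V" "p x = y" "j x = z div r"
      by auto
    have "f x = z"
      using x y by (simp add: f_def)
    with x show "z \<in> f ` V"
      by auto
  qed
  ultimately have "bij_betw f V {0..<r\<^sup>2}"
    by (simp add: bij_betw_def)
  moreover have "bij_betw int {0..<r\<^sup>2} {0..<int (r\<^sup>2)}"
    by (simp add: bij_betw_def image_int_atLeastLessThan del: of_nat_power)
  ultimately have "bij_betw (int \<circ> f) V (carrier (integer_mod_group (r\<^sup>2)))"
    using r_pos by (auto simp: carrier_integer_mod_group intro: bij_betw_trans)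
  moreover have "(int \<circ> f) (p x) = (int r * (int \<circ> f) x) mod int (r\<^sup>2)" if "x \<in> V" for x
  proof -
    have "f (p x) = r * f x mod r\<^sup>2"
      using that two_steps low[OF that] j_root
      by (simp add: f_def[of "p x"] power2_eq_square)
    then show ?thesis
      by (simp only: o_apply of_nat_mult[symmetric] zmod_int[symmetric])
  qed
  ultimately show thesis
    using that by blast
qed

lemma iso_r_G: "digraph_iso (with_proj (functional_graph V p)) (with_proj (r_G r (r\<^sup>2)))"
proof (rule conjugate_to_multiplication)
  fix f :: "'a \<Rightarrow> int"
  assume "bij_betw f V (carrier (integer_mod_group (r\<^sup>2)))"
    and "\<And>x. x \<in> V \<Longrightarrow> f (p x) = (int r * f x) mod int (r\<^sup>2)"
  then show ?thesis
    unfolding r_G_functional_graph using closed by (intro functional_graph_iso) auto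
qed

sublocale G: pair_sym_digraph "functional_graph V p"
  by (rule pair_sym_digraph_functional_graph)

lemma awalk_to_image:
  assumes "x \<in> V"
  shows "\<exists>w. G.awalk x w (p x) \<and> length w \<le> 1"
proof (cases "p x = x")
  case True
  with assms show ?thesis by (intro exI[of _ "[]"]) (simp add: G.awalk_Nil_iff)
next
  case False
  with assms closed show ?thesis
    by (intro exI[of _ "[(x, p x)]"]) (simp add: G.awalk_simps)
qed

text \<open>
  Leaves below two different children of the root are four steps apart: with the depth counted
  negatively in all branches but one, these leaves sit at heights \<open>2\<close> and \<open>-2\<close>.
\<close>

lemma diameter_eq_4:
  assumes "r \<ge> 3"
  shows "diameter (functional_graph V p) = 4"
proof (rule antisym)
  have "\<exists>w. G.awalk x w root \<and> length w \<le> 2" if x: "x \<in> V" for x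
  proof -
    obtain w w' where "G.awalk x w (p x)" "length w \<le> 1" "G.awalk (p x) w' (p (p x))" "length w' \<le> 1"
      using awalk_to_image x closed by meson
    then show ?thesis
      using two_steps[OF x] by (intro exI[of _ "w @ w'"]) (auto intro: G.awalk_appendI)
  qed
  then show "diameter (functional_graph V p) \<le> 4"
    using G.diameter_le_twice_eccentricity[of root 2] by simp
next
  have "card {x \<in> V. p x = root} = r"
    using card_fibre root_in by simp
  then have "card ({x \<in> V. p x = root} - {root}) \<ge> 2"
    using assms root_in by (simp add: card_Diff_singleton)
  then obtain B where B: "B \<subseteq> {x \<in> V. p x = root} - {root}" "card B = 2"
    by (rule obtain_subset_with_card_n)
  then obtain h h' where "B = {h, h'}" "h \<noteq> h'"
    by (auto simp: card_2_iff)
  with B have h: "h \<in> V" "p h = root" "h \<noteq> root" and h': "h' \<in> V" "p h' = root" "h' \<noteq> root"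
    by auto
  obtain l where l: "l \<in> V" "p l = h"
    using fibre_nonempty h by metis
  obtain l' where l': "l' \<in> V" "p l' = h'"
    using fibre_nonempty h' by metis
  define depth :: "'a \<Rightarrow> int" where
    "depth x = (if x = root then 0 else if p x = root then 1 else 2)" for x
  define height where "height x = (if x = h \<or> p x = h then depth x else - depth x)" for x
  have "\<bar>height x - height (p x)\<bar> \<le> 1" if "x \<in> V" for x
    using two_steps[OF that] h by (auto simp: height_def depth_def)
  then have "\<bar>height a - height b\<bar> \<le> 1" if "(a, b) \<in> parcs (functional_graph V p)" for a b
    using that by (auto simp: abs_minus_commute)
  then have "ereal (real_of_int \<bar>height l - height l'\<bar>) \<le> graph_dist (functional_graph V p) l l'"
    by (rule G.graph_dist_ge_potential)
  moreover have "l \<noteq> root" "l' \<noteq> root"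
    using l l' h h' p_root by metis+
  then have "depth l = 2" "depth l' = 2" "l' \<noteq> h"
    using l l' h h' by (auto simp: depth_def)
  then have "height l = 2" "height l' = -2"
    using l l' \<open>h \<noteq> h'\<close> by (simp_all add: height_def)
  ultimately have "4 \<le> graph_dist (functional_graph V p) l l'"
    by simp
  also have "\<dots> \<le> diameter (functional_graph V p)"
    using l l' by (intro graph_dist_le_diameter) auto
  finally show "4 \<le> diameter (functional_graph V p)" .
qed

text \<open>For \<open>r = 2\<close> the graph is a star whose centre is the only child of the root.\<close>

lemma diameter_eq_2:
  assumes "r = 2"
  shows "diameter (functional_graph V p) = 2"
proof -
  have card_2: "card {x \<in> V. p x = y} = 2" if "y \<in> V" "p y = root" for y
    using card_fibre that assms by simp
  have "card ({x \<in> V. p x = root} - {root}) = 1"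
    using card_2[OF root_in] root_in by (simp add: card_Diff_singleton)
  then obtain h where h_only: "{x \<in> V. p x = root} - {root} = {h}"
    by (rule card_1_singletonE)
  then have h: "h \<in> V" "p h = root" "h \<noteq> root"
    by auto
  obtain l l' where ll': "{x \<in> V. p x = h} = {l, l'}" "l \<noteq> l'"
    using card_2[OF h(1,2)] by (auto simp: card_2_iff)
  then have l: "l \<in> V" "p l = h" and l': "l' \<in> V" "p l' = h"
    by auto
  show ?thesis
  proof (rule antisym)
    have "\<exists>w. G.awalk x w h \<and> length w \<le> 1" if x: "x \<in> V" for x
    proof -
      consider "x = root" | "x = h" | "p x = h"
        using h_only closed[OF x] two_steps[OF x] x by blast
      then show ?thesis
      proof cases
        case 1
        with h root_in show ?thesis
          by (intro exI[of _ "[(root, h)]"]) (simp add: G.awalk_simps)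
      next
        case 2
        with h show ?thesis by (intro exI[of _ "[]"]) (simp add: G.awalk_Nil_iff)
      next
        case 3
        with awalk_to_image[OF x] show ?thesis by simp
      qed
    qed
    then show "diameter (functional_graph V p) \<le> 2"
      using G.diameter_le_twice_eccentricity[of h 1] by simp
  next
    define f :: "'a \<Rightarrow> int" where "f x = (if x = l then 0 else if x = l' then 2 else 1)" for x
    have "\<bar>f a - f b\<bar> \<le> 1" if "(a, b) \<in> parcs (functional_graph V p)" for a b
      using that l l' h by (auto simp: f_def)
    then have "ereal (real_of_int \<bar>f l - f l'\<bar>) \<le> graph_dist (functional_graph V p) l l'"
      by (rule G.graph_dist_ge_potential)
    then have "2 \<le> graph_dist (functional_graph V p) l l'"
      using ll' by (simp add: f_def)
    also have "\<dots> \<le> diameter (functional_graph V p)"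
      using l l' by (intro graph_dist_le_diameter) auto
    finally show "2 \<le> diameter (functional_graph V p)" .
  qed
qed

end

section \<open>The parent map of the tree\<close>

lemma out_degree_eq_card_neighbours: "out_degree (with_proj G) v = card {w. (v, w) \<in> parcs G}"
proof -
  have "out_arcs (with_proj G) v = Pair v ` {w. (v, w) \<in> parcs G}"
    by (auto simp: out_arcs_def)
  then show ?thesis
    by (simp add: out_degree_def card_image inj_on_def)
qed

lemma undirected_tree_no_triangle:
  assumes "undirected_tree G" "(a, b) \<in> parcs G" "(b, c) \<in> parcs G" "(c, a) \<in> parcs G"
  shows False
proof -
  interpret pair_bidirected_digraph G
    using assms by (simp add: undirected_tree_def)
  have "cycle [(a, b), (b, c), (c, a)]"
    unfolding cycle_def
    using assms no_loops by (intro exI[of _ a]) (fastforce simp: awalk_simps in_arcsD1)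
  then show False
    using assms(1) by (auto simp: undirected_tree_def)
qed

lemma undirected_tree_closed_set:
  assumes "undirected_tree G" "u \<in> S" "u \<in> pverts G"
    and closed: "\<And>a b. a \<in> S \<Longrightarrow> (a, b) \<in> parcs G \<Longrightarrow> b \<in> S"
  shows "pverts G \<subseteq> S"
proof
  fix v assume v: "v \<in> pverts G"
  interpret pair_bidirected_digraph G
    using assms by (simp add: undirected_tree_def)
  have "u \<rightarrow>\<^sup>*\<^bsub>with_proj (mk_symmetric (with_proj G))\<^esub> v"
    using assms v unfolding undirected_tree_def connected_def strongly_connected_def by auto
  then have "u \<rightarrow>\<^sup>*\<^bsub>with_proj G\<^esub> v"
    by (simp add: reachable_mk_symmetric_eq pair_sym_arcs)
  then show "v \<in> S"
    using \<open>u \<in> S\<close> closed by (induction rule: reachable_induct) auto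
qed

text \<open>
  On the root and its neighbours the map is constantly \<open>v\<^sub>0\<close>, and a leaf is sent to its only
  neighbour. The fibre of a neighbour \<open>h\<close> of the root is then the set of all neighbours of \<open>h\<close> except
  the root, whose size is \<open>(d + 2) - 1\<close>.
\<close>

lemma rooted_tree_parent_map:
  fixes T :: "'a pair_pre_digraph"
  assumes tree: "undirected_tree T"
    and root: "v\<^sub>0 \<in> pverts T"
    and d: "d \<ge> 1"
    and deg_root: "out_degree (with_proj T) v\<^sub>0 = d"
    and not_leaf: "\<forall>w. (v\<^sub>0, w) \<in> parcs T \<longrightarrow> out_degree (with_proj T) w \<noteq> 1"
    and card_hubs: "card {v \<in> pverts T. out_degree (with_proj T) v = d + 2} = d"
    and leaf: "\<forall>v \<in> pverts T. v \<noteq> v\<^sub>0 \<and> out_degree (with_proj T) v \<noteq> d + 2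
           \<longrightarrow> out_degree (with_proj T) v = 1"
  obtains p where "T = functional_graph (pverts T) p" "two_step_map (pverts T) p v\<^sub>0 (d + 1)"
proof -
  interpret pair_bidirected_digraph T
    using tree by (simp add: undirected_tree_def)
  define N where "N v = {w. (v, w) \<in> parcs T}" for v
  define H where "H = N v\<^sub>0"
  have deg: "out_degree (with_proj T) v = card (N v)" for v
    by (simp add: N_def out_degree_eq_card_neighbours)
  have N_sym: "w \<in> N v \<longleftrightarrow> v \<in> N w" for v w
    using arcs_symmetric by (auto simp: N_def)
  have N_irrefl: "v \<notin> N v" for v
    using no_loops by (fastforce simp: N_def)
  have N_sub: "N v \<subseteq> pverts T" for v
    by (auto simp: N_def in_arcsD2)
  \<comment> \<open>The \<open>d\<close> neighbours of the root are among the \<open>d\<close> vertices of degree \<open>d + 2\<close>, hence they are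
    all of them.\<close>
  have H_eq: "H = {v \<in> pverts T. card (N v) = d + 2}"
  proof (rule card_subset_eq)
    show "finite {v \<in> pverts T. card (N v) = d + 2}"
      using card_hubs d by (intro card_ge_0_finite) (simp add: deg)
    show "H \<subseteq> {v \<in> pverts T. card (N v) = d + 2}"
    proof
      fix w assume w: "w \<in> H"
      then have "w \<in> pverts T" "w \<noteq> v\<^sub>0" "card (N w) \<noteq> 1"
        using N_sub N_irrefl not_leaf by (auto simp: H_def deg) (auto simp: N_def)
      then show "w \<in> {v \<in> pverts T. card (N v) = d + 2}"
        using leaf by (auto simp: deg)
    qed
    show "card H = card {v \<in> pverts T. card (N v) = d + 2}"
      using card_hubs deg_root by (simp add: deg H_def)
  qed
  have root_notin: "v\<^sub>0 \<notin> H"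
    by (simp add: H_def N_irrefl)
  have hub_indep: "h' \<notin> N h" if "h \<in> H" "h' \<in> H" for h h'
    using undirected_tree_no_triangle[OF tree, of v\<^sub>0 h h'] that arcs_symmetric
    by (auto simp: H_def N_def)
  define p where "p x = (if x \<in> insert v\<^sub>0 H then v\<^sub>0 else the_elem (N x))" for x
  have p_hub: "p x = v\<^sub>0" if "x \<in> insert v\<^sub>0 H" for x
    using that by (simp add: p_def)
  have p_leaf: "N x = {p x}" if "x \<in> pverts T" "x \<notin> insert v\<^sub>0 H" for x
  proof -
    have "card (N x) = 1"
      using that leaf by (auto simp: deg H_eq)
    then obtain y where "N x = {y}"
      by (rule card_1_singletonE)
    with that show ?thesis
      by (simp add: p_def)
  qed
  have leaf_at_hub: "p x \<in> H" if x: "x \<in> pverts T" "x \<notin> insert v\<^sub>0 H" for x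
  proof (rule ccontr)
    assume not_hub: "p x \<notin> H"
    have "x \<in> N (p x)" "p x \<in> pverts T"
      using p_leaf[OF x] N_sub[of x] N_sym by auto
    moreover from this have "p x \<noteq> v\<^sub>0"
      using x by (auto simp: H_def)
    ultimately have "N (p x) = {x}"
      using p_leaf[of "p x"] not_hub by auto
    \<comment> \<open>Then \<open>x\<close> and its neighbour form a component that misses the root.\<close>
    then have "pverts T \<subseteq> {x, p x}"
      using p_leaf[OF x] x by (intro undirected_tree_closed_set[OF tree, of x]) (auto simp: N_def)
    then show False
      using root x \<open>p x \<noteq> v\<^sub>0\<close> by auto
  qed
  have p_cases: "p x = v\<^sub>0 \<and> x \<in> insert v\<^sub>0 H \<or> p x \<in> H \<and> x \<notin> insert v\<^sub>0 H \<and> N x = {p x}"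
    if "x \<in> pverts T" for x
    using p_hub p_leaf leaf_at_hub that by blast
  have adj_iff: "b \<in> N a \<longleftrightarrow> a \<noteq> b \<and> (p a = b \<or> p b = a)"
    if ab: "a \<in> pverts T" "b \<in> pverts T" for a b
  proof
    assume b: "b \<in> N a"
    then have "a \<in> N b" "a \<noteq> b"
      using N_sym N_irrefl by auto
    then show "a \<noteq> b \<and> (p a = b \<or> p b = a)"
      using p_cases[OF ab(1)] p_cases[OF ab(2)] b hub_indep by (metis insert_iff singletonD)
  next
    have "p x \<in> N x" if "x \<in> pverts T" "p x \<noteq> x" for x
      using p_cases[OF that(1)] that(2) N_sym by (auto simp: H_def)
    moreover assume "a \<noteq> b \<and> (p a = b \<or> p b = a)"
    ultimately show "b \<in> N a"
      using ab N_sym by metis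
  qed
  have "T = functional_graph (pverts T) p"
  proof (rule pair_pre_digraph.equality)
    have "(a, b) \<in> parcs T \<longleftrightarrow> (a, b) \<in> parcs (functional_graph (pverts T) p)" for a b
      using adj_iff[of a b] in_arcsD1 in_arcsD2 by (auto simp: N_def)
    then show "parcs T = parcs (functional_graph (pverts T) p)"
      by auto
  qed auto
  moreover have "two_step_map (pverts T) p v\<^sub>0 (d + 1)"
  proof
    fix x assume x: "x \<in> pverts T"
    show "p x \<in> pverts T" "p (p x) = v\<^sub>0"
      using p_cases[OF x] p_hub root N_sub[of v\<^sub>0] by (auto simp: H_def)
  next
    fix y assume y: "y \<in> pverts T" "p y = v\<^sub>0"
    show "card {x \<in> pverts T. p x = y} = d + 1"
    proof (cases "y = v\<^sub>0")
      case True
      have "{x \<in> pverts T. p x = v\<^sub>0} = insert v\<^sub>0 H"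
        using p_cases root_notin root p_hub N_sub by (auto simp: H_def)
      moreover have "finite H" "card H = d"
        using deg_root d by (auto simp: deg H_def intro: card_ge_0_finite)
      ultimately show ?thesis
        using True root_notin by simp
    next
      case False
      then have "y \<in> H"
        using p_cases[OF y(1)] y(2) root_notin by auto
      have "x \<in> pverts T \<and> p x = y \<longleftrightarrow> x \<in> N y - {v\<^sub>0}" for x
        using adj_iff[OF y(1), of x] N_sub[of y] p_hub[of v\<^sub>0] p_hub[of y] False \<open>y \<in> H\<close>
          p_cases[of x] y by auto
      then have "{x \<in> pverts T. p x = y} = N y - {v\<^sub>0}"
        by auto
      moreover have "v\<^sub>0 \<in> N y"
        using \<open>y \<in> H\<close> N_sym by (simp add: H_def)
      moreover have "card (N y) = d + 2"
        using \<open>y \<in> H\<close> H_eq by simp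
      ultimately show ?thesis
        by (simp add: card_Diff_singleton)
    qed
  qed (use root in auto)
  ultimately show thesis
    using that by blast
qed

theorem theorem3p15:
  fixes T :: "'a pair_pre_digraph" and v\<^sub>0 :: 'a and d n :: nat
  assumes "undirected_tree T"
    and "v\<^sub>0 \<in> pverts T"
    and "d \<ge> 1"
    and "out_degree (with_proj T) v\<^sub>0 = d"
    and "\<forall>w. (v\<^sub>0, w) \<in> parcs T \<longrightarrow> out_degree (with_proj T) w \<noteq> 1"
    and "card {v \<in> pverts T. out_degree (with_proj T) v = d + 2} = d"
    and "\<forall>v \<in> pverts T. v \<noteq> v\<^sub>0 \<and> out_degree (with_proj T) v \<noteq> d + 2
           \<longrightarrow> out_degree (with_proj T) v = 1"
    and "n = (d + 1)\<^sup>2"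
  shows "digraph_iso (with_proj T) (with_proj (r_G (d + 1) n)) \<and>
         (d = 1 \<longrightarrow> diameter T = 2) \<and>
         (d \<noteq> 1 \<longrightarrow> diameter T = 4)"
proof -
  obtain p where T: "T = functional_graph (pverts T) p"
      and "two_step_map (pverts T) p v\<^sub>0 (d + 1)"
    using assms by (elim rooted_tree_parent_map)
  then interpret two_step_map "pverts T" p v\<^sub>0 "d + 1"
    by simp
  have "digraph_iso (with_proj T) (with_proj (r_G (d + 1) n))"
    unfolding \<open>n = (d + 1)\<^sup>2\<close> by (subst T) (rule iso_r_G)
  moreover have "diameter T = 2" if "d = 1"
    using that by (subst T) (simp add: diameter_eq_2)
  moreover have "diameter T = 4" if "d \<noteq> 1"
    using that \<open>d \<ge> 1\<close> by (subst T) (simp add: diameter_eq_4)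
  ultimately show ?thesis
    by simp
qed

end
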